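(* Let $(n_k)_{k\ge 0}$ be a strictly increasing sequence of positive integers with $n_0=1$ and let $c$ be a real number such that $$\sup_{k\ge 0}\frac{n_{k+1}}{n_k}\le c<+\infty .$$ Then $(n_k)_{k\ge 0}$ is NSS for the class of Banach-Lie groups and for the class of topological groups possessing a minimal metric.
   Context: NSS: for a topological group $G$, $(G,(n_k)_{k\ge 0})$ is NSS if there exists a neighborhood $U$ of the identity $e$ of $G$ such that, for $g\in G$, if $g^{n_k}\in U$ for every $k\ge 0$, then $g=e$. The sequence $(n_k)_{k\ge 0}$ is NSS for a class $\mathcal{C}$ of topological groups if $(G,(n_k)_{k\ge 0})$ is NSS for each $G$ in $\mathcal{C}$ (the neighborhood may depend on $G$). Minimal metric: a metric $d$ on a (metrizable) topological group $G$ is minimal if it is compatible with the topology of $G$, left-invariant (that is, $d(hg,hf)=d(g,f)$ for all $g,f,h\in G$) and, for every other compatible left-invariant metric $\partial$ on $G$, there are a neighborhood $U$ of the identity $e$ and a constant $K>0$ such that $d(g,f)\le K\,\partial(g,f)$ for all $g,f\in U$. Banach-Lie groups are real or complex Lie groups modelled on Banach spaces, in the usual sense. *)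

theory Defs
  imports "HOL-Analysis.Analysis" "HOL-Algebra.Group"
begin

text \<open>Topological groups are not assumed to be Hausdorff. Both classes considered below
  consist of Hausdorff groups anyway: a metrizable group is Hausdorff, and a topological group
  that is locally homeomorphic to a Banach space is T1, hence Hausdorff.\<close>

locale topological_group = group G for G :: "('g, 'm) monoid_scheme" (structure) +
  fixes T :: "'g topology"
  assumes topspace_eq: "topspace T = carrier G"
    and continuous_mult: "continuous_map (prod_topology T T) T (\<lambda>(x, y). x \<otimes> y)"
    and continuous_inv: "continuous_map T T (\<lambda>x. inv x)"

definition is_nbhd :: "'a topology \<Rightarrow> 'a \<Rightarrow> 'a set \<Rightarrow> bool" where
  "is_nbhd T x U \<longleftrightarrow> U \<subseteq> topspace T \<and> (\<exists>V. openin T V \<and> x \<in> V \<and> V \<subseteq> U)"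

definition NSS :: "'g monoid \<Rightarrow> 'g topology \<Rightarrow> (nat \<Rightarrow> nat) \<Rightarrow> bool" where
  "NSS G T n \<longleftrightarrow>
     (\<exists>U. is_nbhd T \<one>\<^bsub>G\<^esub> U \<and>
          (\<forall>g\<in>carrier G. (\<forall>k. g [^]\<^bsub>G\<^esub> n k \<in> U) \<longrightarrow> g = \<one>\<^bsub>G\<^esub>))"

definition NSS_for_class :: "('g monoid \<times> 'g topology) set \<Rightarrow> (nat \<Rightarrow> nat) \<Rightarrow> bool" where
  "NSS_for_class C n \<longleftrightarrow> (\<forall>(G, T)\<in>C. NSS G T n)"


section \<open>Minimal metrics\<close>

text \<open>The locale \<^locale>\<open>Metric_space\<close> asks for nonnegativity and symmetry also outside the carrier.
  This is harmless: only values on the carrier matter, and a metric on the carrier can be extended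
  by 0.\<close>

definition compatible_left_invariant_metric ::
    "'g monoid \<Rightarrow> 'g topology \<Rightarrow> ('g \<Rightarrow> 'g \<Rightarrow> real) \<Rightarrow> bool" where
  "compatible_left_invariant_metric G T d \<longleftrightarrow>
     Metric_space (carrier G) d \<and> Metric_space.mtopology (carrier G) d = T \<and>
     (\<forall>g\<in>carrier G. \<forall>f\<in>carrier G. \<forall>h\<in>carrier G. d (h \<otimes>\<^bsub>G\<^esub> g) (h \<otimes>\<^bsub>G\<^esub> f) = d g f)"

definition minimal_metric :: "'g monoid \<Rightarrow> 'g topology \<Rightarrow> ('g \<Rightarrow> 'g \<Rightarrow> real) \<Rightarrow> bool" where
  "minimal_metric G T d \<longleftrightarrow>
     compatible_left_invariant_metric G T d \<and>
     (\<forall>d'. compatible_left_invariant_metric G T d' \<longrightarrow>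
        (\<exists>U K. is_nbhd T \<one>\<^bsub>G\<^esub> U \<and> K > 0 \<and> (\<forall>g\<in>U. \<forall>f\<in>U. d g f \<le> K * d' g f)))"

definition minimal_metric_groups :: "('g monoid \<times> 'g topology) set" where
  "minimal_metric_groups = {(G, T). topological_group G T \<and> (\<exists>d. minimal_metric G T d)}"


section \<open>Smooth maps between Banach spaces\<close>

text \<open>A scalar multiplication by a normed field \<open>'k\<close> (below: the reals or the complex numbers)
  that refines the given real normed vector space structure. For \<open>'k = complex\<close> on a type of class
  \<^class>\<open>banach\<close> this is precisely a complex Banach space.\<close>

definition normed_scalars :: "('k::real_normed_field \<Rightarrow> 'a::real_normed_vector \<Rightarrow> 'a) \<Rightarrow> bool" where
  "normed_scalars s \<longleftrightarrow>
     vector_space s \<and> (\<forall>r x. s (of_real r) x = r *\<^sub>R x) \<and> (\<forall>c x. norm (s c x) = norm c * norm x)"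

text \<open>Bounded \<open>k\<close>-linear maps over \<open>'k\<close>. The \<open>k\<close> arguments are passed as a list; values on lists of
  another length are irrelevant.\<close>

definition bounded_multilinear ::
    "('k \<Rightarrow> 'a::real_normed_vector \<Rightarrow> 'a) \<Rightarrow> ('k \<Rightarrow> 'b::real_normed_vector \<Rightarrow> 'b) \<Rightarrow>
     nat \<Rightarrow> ('a list \<Rightarrow> 'b) \<Rightarrow> bool" where
  "bounded_multilinear sa sb k m \<longleftrightarrow>
     (\<forall>us ws x y. length us + 1 + length ws = k \<longrightarrow>
        m (us @ (x + y) # ws) = m (us @ x # ws) + m (us @ y # ws)) \<and>
     (\<forall>us ws c x. length us + 1 + length ws = k \<longrightarrow>
        m (us @ sa c x # ws) = sb c (m (us @ x # ws))) \<and>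
     (\<exists>B. \<forall>vs. length vs = k \<longrightarrow> norm (m vs) \<le> B * prod_list (map norm vs))"

text \<open>\<open>C\<^sup>\<infinity>\<close> maps over \<open>'k\<close> in the sense of Frechet. \<open>D k x\<close> is the \<open>k\<close>-th derivative at \<open>x\<close>, a bounded
  \<open>k\<close>-linear map over \<open>'k\<close>; the last conjunct says that \<open>D (Suc k) x\<close> is the Frechet derivative
  at \<open>x\<close> of \<open>D k\<close> with respect to the operator norm on \<open>k\<close>-linear maps. (The library's
  \<^const>\<open>has_derivative\<close> cannot be iterated a variable number of times, since each
  differentiation changes the type of the map.) Over the complex numbers, the \<open>C\<^sup>\<infinity>\<close> maps are
  the holomorphic (equivalently, complex analytic) maps.\<close>

definition smooth_over ::
    "('k \<Rightarrow> 'a::real_normed_vector \<Rightarrow> 'a) \<Rightarrow> ('k \<Rightarrow> 'b::real_normed_vector \<Rightarrow> 'b) \<Rightarrow>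
     'a set \<Rightarrow> ('a \<Rightarrow> 'b) \<Rightarrow> bool" where
  "smooth_over sa sb S f \<longleftrightarrow> open S \<and>
     (\<exists>D :: nat \<Rightarrow> 'a \<Rightarrow> 'a list \<Rightarrow> 'b.
        (\<forall>x\<in>S. D 0 x [] = f x) \<and>
        (\<forall>k. \<forall>x\<in>S. bounded_multilinear sa sb k (D k x)) \<and>
        (\<forall>k. \<forall>x\<in>S. \<forall>\<epsilon>>0. \<exists>\<delta>>0. \<forall>y\<in>S. norm (y - x) < \<delta> \<longrightarrow>
           (\<forall>vs. length vs = k \<longrightarrow>
              norm (D k y vs - D k x vs - D (Suc k) x ((y - x) # vs))
                \<le> \<epsilon> * norm (y - x) * prod_list (map norm vs))))"


section \<open>Banach-Lie groups\<close>

text \<open>A chart \<open>(U, \<phi>)\<close> has domain \<open>U\<close>; the values of \<open>\<phi>\<close> outside \<open>U\<close> are irrelevant.\<close>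

type_synonym ('g, 'e) chart = "'g set \<times> ('g \<Rightarrow> 'e)"

definition chart_on :: "'g topology \<Rightarrow> ('g, 'e::real_normed_vector) chart \<Rightarrow> bool" where
  "chart_on T = (\<lambda>(U, \<phi>). openin T U \<and> open (\<phi> ` U) \<and>
     homeomorphic_map (subtopology T U) (top_of_set (\<phi> ` U)) \<phi>)"

definition smooth_atlas ::
    "('k \<Rightarrow> 'e::real_normed_vector \<Rightarrow> 'e) \<Rightarrow> 'g topology \<Rightarrow> ('g, 'e) chart set \<Rightarrow> bool" where
  "smooth_atlas s T A \<longleftrightarrow>
     (\<forall>C\<in>A. chart_on T C) \<and> (\<Union>(U, \<phi>)\<in>A. U) = topspace T \<and>
     (\<forall>(U, \<phi>)\<in>A. \<forall>(V, \<psi>)\<in>A. smooth_over s s (\<phi> ` (U \<inter> V)) (\<psi> \<circ> inv_into U \<phi>))"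

text \<open>All charts take values in a single model space. This is no restriction for a group, because
  left translations identify the model spaces at any two points.\<close>

definition lie_group_over ::
    "('k::real_normed_field \<Rightarrow> 'e::banach \<Rightarrow> 'e) \<Rightarrow> 'g monoid \<Rightarrow> 'g topology \<Rightarrow>
     ('g, 'e) chart set \<Rightarrow> bool" where
  "lie_group_over s G T A \<longleftrightarrow>
     topological_group G T \<and> normed_scalars s \<and> smooth_atlas s T A \<and>
     (\<forall>(U, \<phi>)\<in>A. \<forall>(V, \<psi>)\<in>A. \<forall>(W, \<theta>)\<in>A.
        smooth_over (\<lambda>c. map_prod (s c) (s c)) s
          {(x, y). x \<in> \<phi> ` U \<and> y \<in> \<psi> ` V \<and> inv_into U \<phi> x \<otimes>\<^bsub>G\<^esub> inv_into V \<psi> y \<in> W}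
          (\<lambda>(x, y). \<theta> (inv_into U \<phi> x \<otimes>\<^bsub>G\<^esub> inv_into V \<psi> y))) \<and>
     (\<forall>(U, \<phi>)\<in>A. \<forall>(V, \<psi>)\<in>A.
        smooth_over s s
          {x. x \<in> \<phi> ` U \<and> inv\<^bsub>G\<^esub> (inv_into U \<phi> x) \<in> V}
          (\<lambda>x. \<psi> (inv\<^bsub>G\<^esub> (inv_into U \<phi> x))))"

definition real_lie_group :: "'g monoid \<Rightarrow> 'g topology \<Rightarrow> ('g, 'e::banach) chart set \<Rightarrow> bool" where
  "real_lie_group G T A \<longleftrightarrow> lie_group_over (scaleR :: real \<Rightarrow> 'e \<Rightarrow> 'e) G T A"

definition complex_lie_group :: "'g monoid \<Rightarrow> 'g topology \<Rightarrow> ('g, 'e::banach) chart set \<Rightarrow> bool" where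
  "complex_lie_group G T A \<longleftrightarrow> (\<exists>s :: complex \<Rightarrow> 'e \<Rightarrow> 'e. lie_group_over s G T A)"

text \<open>The model space is a type argument, since one cannot quantify over types within a
  formula.\<close>

definition banach_lie_groups :: "'e::banach itself \<Rightarrow> ('g monoid \<times> 'g topology) set" where
  "banach_lie_groups _ =
     {(G, T). \<exists>A :: ('g, 'e) chart set. real_lie_group G T A \<or> complex_lie_group G T A}"

end

theory Submission
  imports Defs
begin

text \<open>
  In both classes the topology near the unit is described by a function \<open>N \<ge> 0\<close> vanishing only at the unit
  whose values on powers grow linearly: there are constants \<open>R, K > 0\<close> such that, near the unit,
  \<open>m * N g \<le> R\<close> implies \<open>m * N g \<le> K * N (g\<^bsup>m\<^esup>)\<close>. This alone suffices
  (\<open>NSS_of_linear_power_growth\<close>): if all \<open>N (g\<^bsup>n k\<^esup>)\<close> are small, then \<open>n k * N g\<close> stays bounded, because the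
  bounded ratio of consecutive exponents never allows it to jump beyond \<open>R\<close>; hence \<open>N g = 0\<close>.

  For a Banach-Lie group, \<open>N\<close> is the norm in a chart centred at the unit. There the product is
  \<open>x + y\<close> up to an error of at most \<open>\<parallel>y\<parallel> / 2\<close> (\<open>local_group_law_approx_addition\<close>), so the \<open>m\<close>-th power of an
  element with coordinate \<open>x\<close> has a coordinate of norm at least \<open>m * \<parallel>x\<parallel> / 2\<close> as long as
  \<open>m * \<parallel>x\<parallel>\<close> is small.

  For a minimal metric \<open>d\<close>, \<open>N g = d g \<one>\<close>. The key is that some power of \<open>g\<close> with exponent of order \<open>1 / N g\<close>
  leaves a fixed ball (\<open>minimal_metric_power_escape\<close>); division with remainder then gives linear growth.
  Otherwise there are elements \<open>g\<close> arbitrarily close to the unit with all powers up to order \<open>1 / N g\<close> arbitrarily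
  small. Such elements admit a cheaper metric: a Birkhoff-Kakutani construction along a chain of
  neighbourhoods adapted to them (\<open>nbhd_chain\<close>) yields a compatible left-invariant metric in which the
  distance of \<open>g\<close> from the unit is \<open>o(N g)\<close>, and this contradicts minimality.
\<close>

section \<open>From linear growth of powers to NSS\<close>

text \<open>With \<open>U = {g \<in> A. N g < r}\<close> for small \<open>r\<close>, suppose that all powers \<open>g\<^bsup>n k\<^esup>\<close> lie in \<open>U\<close>.
  The bound \<open>n k * N g \<le> R\<close> passes from \<open>k\<close> to \<open>k + 1\<close>: the growth hypothesis improves it to
  \<open>n k * N g \<le> K * r \<le> R / c\<close>, which leaves room for the factor \<open>c\<close> lost in going to the next exponent. So
  \<open>n k * N g\<close> is bounded while \<open>n k \<longlonglongrightarrow> \<infinity>\<close>, which forces \<open>N g = 0\<close>.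

  Only the powers \<open>g\<^bsup>n k\<^esup>\<close> are known to be close to the unit. This is why the growth hypothesis is
  conditioned on \<open>m * N g\<close> instead of the position of \<open>g, \<dots>, g\<^bsup>m\<^esup>\<close>.\<close>

lemma NSS_of_linear_power_growth:
  fixes G :: "'g monoid" and T :: "'g topology" and N :: "'g \<Rightarrow> real"
    and n :: "nat \<Rightarrow> nat" and c R K :: real
  assumes G: "group G"
    and n_mono: "strict_mono n" and n_0: "n 0 = 1"
    and ratio: "\<And>k. real (n (Suc k)) \<le> c * real (n k)"
    and R: "R > 0" and K: "K > 0"
    and nbhd: "\<And>r. r > 0 \<Longrightarrow> is_nbhd T \<one>\<^bsub>G\<^esub> {g\<in>A. N g < r}"
    and nonneg: "\<And>g. N g \<ge> 0"
    and definite: "\<And>g. g \<in> A \<Longrightarrow> N g = 0 \<Longrightarrow> g = \<one>\<^bsub>G\<^esub>"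
    and growth: "\<And>g m. g \<in> A \<Longrightarrow> real m * N g \<le> R \<Longrightarrow> real m * N g \<le> K * N (g [^]\<^bsub>G\<^esub> m)"
  shows "NSS G T n"
proof -
  interpret group G by (rule G)
  have "real (n 0) < real (n (Suc 0))"
    using n_mono by (simp add: strict_mono_less)
  with ratio[of 0] n_0 have c: "c > 0" by simp
  define r where "r = min R (R / (c * K))"
  have r: "r > 0" "r \<le> R" "c * (K * r) \<le> R"
    using R K c by (auto simp: r_def min_def field_simps)
  have trivial: "g = \<one>\<^bsub>G\<^esub>" if powers: "\<And>k. g [^]\<^bsub>G\<^esub> n k \<in> {g\<in>A. N g < r}" and g: "g \<in> carrier G" for g
  proof (rule ccontr)
    assume "g \<noteq> \<one>\<^bsub>G\<^esub>"
    have gA: "g \<in> A" and "N g < r"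
      using powers[of 0] g n_0 by auto
    have bounded: "real (n k) * N g \<le> R" for k
    proof (induction k)
      case 0
      show ?case using n_0 \<open>N g < r\<close> r by simp
    next
      case (Suc k)
      have "real (n k) * N g \<le> K * r"
        using growth[OF gA Suc.IH] powers[of k] K by (smt (verit) mem_Collect_eq mult_left_mono)
      have "real (n (Suc k)) * N g \<le> c * (real (n k) * N g)"
        using mult_right_mono[OF ratio[of k] nonneg[of g]] by (simp add: mult.assoc)
      also have "\<dots> \<le> c * (K * r)" using \<open>_ \<le> K * r\<close> c by simp
      finally show ?case using r by simp
    qed
    have "N g > 0" using definite[OF gA] nonneg[of g] \<open>g \<noteq> _\<close> by fastforce
    then obtain k :: nat where "R / N g < real k" using reals_Archimedean2 by blast
    also have "real k \<le> real (n k)" using strict_mono_imp_increasing[OF n_mono] by simp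
    finally show False using bounded[of k] \<open>N g > 0\<close> by (simp add: field_simps)
  qed
  show ?thesis unfolding NSS_def
    by (intro exI[of _ "{g\<in>A. N g < r}"] conjI nbhd r ballI impI) (use trivial in blast)
qed


section \<open>Banach-Lie groups\<close>

text \<open>The second derivative bounds the variation of the first one, which makes the latter continuous in
  operator norm. As the scalars extend the real ones, the first derivative is real linear also in the
  complex case, hence a derivative in the sense of \<^const>\<open>has_derivative\<close>.\<close>

lemma smooth_over_imp_continuously_differentiable:
  fixes sa :: "'k::real_normed_field \<Rightarrow> 'a::real_normed_vector \<Rightarrow> 'a"
    and sb :: "'k \<Rightarrow> 'b::real_normed_vector \<Rightarrow> 'b"
  assumes f: "smooth_over sa sb S f" and x: "x \<in> S"
    and sa: "\<And>r v. sa (of_real r) v = r *\<^sub>R v" and sb: "\<And>r v. sb (of_real r) v = r *\<^sub>R v"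
  obtains f' where "\<And>y. y \<in> S \<Longrightarrow> (f has_derivative f' y) (at y)"
    and "\<And>e. e > 0 \<Longrightarrow> \<exists>d>0. \<forall>y. norm (y - x) < d \<longrightarrow> y \<in> S \<and> (\<forall>v. norm (f' y v - f' x v) \<le> e * norm v)"
proof -
  from f have S: "open S" by (simp add: smooth_over_def)
  from f obtain D where D_all: "(\<forall>y\<in>S. D 0 y [] = f y) \<and>
      (\<forall>k. \<forall>y\<in>S. bounded_multilinear sa sb k (D k y)) \<and>
      (\<forall>k. \<forall>y\<in>S. \<forall>e>0. \<exists>d>0. \<forall>z\<in>S. norm (z - y) < d \<longrightarrow>
         (\<forall>vs. length vs = k \<longrightarrow>
            norm (D k z vs - D k y vs - D (Suc k) y ((z - y) # vs))
              \<le> e * norm (z - y) * prod_list (map norm vs)))"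
    unfolding smooth_over_def by (elim conjE[of "open S"] exE) (rule that)
  note D0 = conjunct1[OF D_all, rule_format]
    and D = conjunct1[OF conjunct2[OF D_all], rule_format]
    and deriv = conjunct2[OF conjunct2[OF D_all], rule_format]
  have lin: "bounded_linear (\<lambda>v. D 1 y [v])" if y: "y \<in> S" for y
  proof -
    note multilinear = D[OF y, of 1, unfolded bounded_multilinear_def]
    note add = conjunct1[OF multilinear, rule_format]
    note scale = conjunct1[OF conjunct2[OF multilinear], rule_format]
    obtain B where B: "\<And>vs. length vs = 1 \<Longrightarrow> norm (D 1 y vs) \<le> B * prod_list (map norm vs)"
      using conjunct2[OF conjunct2[OF multilinear]] by (elim exE) (rule that; blast)
    show ?thesis
    proof (rule bounded_linear_intro[of _ B])
      show "D 1 y [v + w] = D 1 y [v] + D 1 y [w]" for v w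
        using add[of "[]" "[]" v w] by simp
      show "D 1 y [r *\<^sub>R v] = r *\<^sub>R D 1 y [v]" for r v
        using scale[of "[]" "[]" "of_real r" v] by (simp add: sa sb)
      show "norm (D 1 y [v]) \<le> norm v * B" for v
        using B[of "[v]"] by (simp add: mult.commute)
    qed
  qed
  show ?thesis
  proof (rule that[of "\<lambda>y v. D 1 y [v]"])
    fix y assume y: "y \<in> S"
    have "(f has_derivative (\<lambda>v. D 1 y [v])) (at y within S)"
      unfolding has_derivative_within_alt
    proof (intro conjI allI impI lin[OF y])
      fix e :: real assume "e > 0"
      from deriv[OF y this, of 0] obtain d where d: "d > 0"
        and "\<And>z. z \<in> S \<Longrightarrow> norm (z - y) < d \<Longrightarrow>
          norm (D 0 z [] - D 0 y [] - D 1 y [z - y]) \<le> e * norm (z - y)"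
        by fastforce
      then show "\<exists>d>0. \<forall>z\<in>S. norm (z - y) < d \<longrightarrow>
          norm (f z - f y - D 1 y [z - y]) \<le> e * norm (z - y)"
        using D0 y by (intro exI[of _ d]) simp
    qed
    then show "(f has_derivative (\<lambda>v. D 1 y [v])) (at y)"
      using at_within_open[OF y S] by simp
  next
    fix e :: real assume e: "e > 0"
    obtain B where B: "\<And>vs. length vs = 2 \<Longrightarrow> norm (D 2 x vs) \<le> B * prod_list (map norm vs)"
      using D[OF x, of 2] unfolding bounded_multilinear_def
      by (elim conjE exE) (rule that; blast)
    obtain d1 where d1: "d1 > 0" and C: "\<And>z vs. z \<in> S \<Longrightarrow> norm (z - x) < d1 \<Longrightarrow> length vs = 1 \<Longrightarrow>
        norm (D 1 z vs - D 1 x vs - D 2 x ((z - x) # vs)) \<le> 1 * norm (z - x) * prod_list (map norm vs)"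
      using deriv[OF x zero_less_one, of 1] unfolding Suc_1 by (elim conjE exE) (rule that; blast)
    obtain d2 where d2: "d2 > 0" "ball x d2 \<subseteq> S"
      using S x by (meson open_contains_ball)
    define d where "d = min (min d1 d2) (e / (1 + \<bar>B\<bar>))"
    have "d > 0" using d1 d2 e by (simp add: d_def add_pos_nonneg)
    moreover have "y \<in> S \<and> (\<forall>v. norm (D 1 y [v] - D 1 x [v]) \<le> e * norm v)"
      if y: "norm (y - x) < d" for y
    proof (intro conjI allI)
      show yS: "y \<in> S" using d2 y by (auto simp: d_def dist_norm norm_minus_commute)
      fix v
      have "norm (D 1 y [v] - D 1 x [v]) \<le>
          norm (D 1 y [v] - D 1 x [v] - D 2 x [y - x, v]) + norm (D 2 x [y - x, v])"
        by (metis diff_add_cancel norm_triangle_ineq)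
      also have "\<dots> \<le> norm (y - x) * norm v + B * (norm (y - x) * norm v)"
        using C[OF yS, of "[v]"] B[of "[y - x, v]"] y by (simp add: d_def)
      also have "\<dots> \<le> norm (y - x) * norm v + \<bar>B\<bar> * (norm (y - x) * norm v)"
        by (intro add_left_mono mult_right_mono) auto
      also have "\<dots> = ((1 + \<bar>B\<bar>) * norm (y - x)) * norm v" by (simp add: algebra_simps)
      also have "\<dots> \<le> e * norm v"
      proof (rule mult_right_mono)
        have "norm (y - x) \<le> e / (1 + \<bar>B\<bar>)" using y by (simp add: d_def)
        then show "(1 + \<bar>B\<bar>) * norm (y - x) \<le> e" by (simp add: field_simps)
      qed simp
      finally show "norm (D 1 y [v] - D 1 x [v]) \<le> e * norm v" .
    qed
    ultimately show "\<exists>d>0. \<forall>y. norm (y - x) < d \<longrightarrow>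
        y \<in> S \<and> (\<forall>v. norm (D 1 y [v] - D 1 x [v]) \<le> e * norm v)" by blast
  qed
qed

text \<open>The unit laws determine the derivative of a local group law at the unit, so \<open>F (x, y)\<close> is near
  \<open>x + y\<close>. What matters is that the error is small relative to \<open>y\<close> alone: it is estimated by the
  mean value inequality for \<open>t \<mapsto> F (x, t) - t\<close> between \<open>p\<close> and \<open>y\<close>. When \<open>x\<close> is a high power of the element
  with coordinate \<open>y\<close>, an error comparable to \<open>x\<close> would be useless.\<close>

lemma local_group_law_approx_addition:
  fixes F :: "'e::real_normed_vector \<times> 'e \<Rightarrow> 'e" and p :: 'e
  assumes unit_right: "\<And>x. (x, p) \<in> S \<Longrightarrow> F (x, p) = x"
    and unit_left: "\<And>y. (p, y) \<in> S \<Longrightarrow> F (p, y) = y"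
    and deriv: "\<And>z. z \<in> S \<Longrightarrow> (F has_derivative F' z) (at z)"
    and cont: "\<And>e. e > 0 \<Longrightarrow> \<exists>d>0. \<forall>z. norm (z - (p, p)) < d \<longrightarrow>
        z \<in> S \<and> (\<forall>v. norm (F' z v - F' (p, p) v) \<le> e * norm v)"
  obtains R where "R > 0"
    and "\<And>x y. norm (x - p) < R \<Longrightarrow> norm (y - p) < R \<Longrightarrow>
        (x, y) \<in> S \<and> norm (F (x, y) - x - (y - p)) \<le> norm (y - p) / 2"
proof -
  obtain d where d: "d > 0" and near: "\<And>z. norm (z - (p, p)) < d \<Longrightarrow> z \<in> S"
    and close: "\<And>z v. norm (z - (p, p)) < d \<Longrightarrow> norm (F' z v - F' (p, p) v) \<le> 1/2 * norm v"
    using cont[of "1/2"] by auto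
  have partial: "((\<lambda>y. F (x, y)) has_derivative (\<lambda>v. F' (x, y) (0, v))) (at y within Y)"
    if "(x, y) \<in> S" for x y Y
  proof -
    have "((\<lambda>y. (x, y)) has_derivative (\<lambda>v. (0, v))) (at y within Y)"
      by (auto intro!: derivative_eq_intros)
    from has_derivative_compose[OF this deriv[OF that]] show ?thesis .
  qed
  have box: "norm ((x, y) - (p, p)) < d" if "norm (x - p) < d / 2" "norm (y - p) < d / 2" for x y
    using norm_Pair_le[of "x - p" "y - p"] that by simp
  have id: "F' (p, p) (0, v) = v" for v
  proof -
    have "((\<lambda>y. F (p, y)) has_derivative (\<lambda>v. v)) (at p)"
    proof (rule has_derivative_transform_within_open[where f = "\<lambda>y. y" and s = "ball p (d / 2)"])
      show "y = F (p, y)" if "y \<in> ball p (d / 2)" for y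
        using unit_left near box[of p y] that d by (simp add: dist_norm norm_minus_commute)
    qed (use d in \<open>auto intro!: derivative_eq_intros\<close>)
    moreover have "(p, p) \<in> S" using near[of "(p,p)"] d by (simp add: zero_prod_def)
    ultimately show ?thesis
      using has_derivative_unique[OF partial[of p p UNIV]] by metis
  qed
  show ?thesis
  proof (rule that[of "d / 2"])
    fix x y assume x: "norm (x - p) < d / 2" and y: "norm (y - p) < d / 2"
    let ?Y = "ball p (d / 2)"
    have S: "(x, t) \<in> S" if "t \<in> ?Y" for t
      using near box x that by (simp add: dist_norm norm_minus_commute)
    have "norm ((F (x, y) - y) - (F (x, p) - p)) \<le> 1/2 * norm (y - p)"
    proof (rule differentiable_bound[where S = ?Y and f' = "\<lambda>t v. F' (x, t) (0, v) - v"])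
      fix t assume t: "t \<in> ?Y"
      show "((\<lambda>y. F (x, y) - y) has_derivative (\<lambda>v. F' (x, t) (0, v) - v)) (at t within ?Y)"
        by (intro has_derivative_diff has_derivative_ident partial S t)
      show "onorm (\<lambda>v. F' (x, t) (0, v) - v) \<le> 1/2"
      proof (rule onorm_bound)
        fix v
        have "norm ((x, t) - (p, p)) < d"
          using box[of x t] x t by (simp add: dist_norm norm_minus_commute)
        from close[OF this, of "(0, v)"] show "norm (F' (x, t) (0, v) - v) \<le> 1/2 * norm v"
          by (simp add: id norm_Pair)
      qed simp
    qed (use d y in \<open>auto simp: dist_norm norm_minus_commute\<close>)
    moreover have "F (x, p) = x"
      using unit_right S[of p] d by simp
    moreover have "(x, y) \<in> S" using S[of y] y by (simp add: dist_norm norm_minus_commute)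
    ultimately show "(x, y) \<in> S \<and> norm (F (x, y) - x - (y - p)) \<le> norm (y - p) / 2"
      by (simp add: algebra_simps)
  qed (use d in simp)
qed

text \<open>In a chart around the unit, \<open>N\<close> is the distance of the coordinate to that of the unit. Each
  multiplication by \<open>g\<close> moves the coordinate by \<open>\<phi> g - p\<close> up to half of its norm, so \<open>\<phi> (g\<^bsup>m\<^esup>)\<close> stays within
  \<open>m * N g / 2\<close> of \<open>p + m *\<^sub>R (\<phi> g - p)\<close> as long as this does not leave the region where the group law
  is approximately additive.\<close>

lemma lie_group_NSS:
  fixes s :: "'k::real_normed_field \<Rightarrow> 'e::banach \<Rightarrow> 'e" and G :: "'g monoid"
  assumes lie: "lie_group_over s G T A"
    and n_mono: "strict_mono n" and n_0: "n 0 = 1"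
    and ratio: "\<And>k. real (n (Suc k)) \<le> c * real (n k)"
  shows "NSS G T n"
proof -
  interpret topological_group G T using lie by (simp add: lie_group_over_def)
  have scalars: "s (of_real r) x = r *\<^sub>R x" for r x
    using lie by (simp add: lie_group_over_def normed_scalars_def)
  have atlas: "smooth_atlas s T A" using lie by (simp add: lie_group_over_def)
  then obtain U \<phi> where chart: "(U, \<phi>) \<in> A" and eU: "\<one>\<^bsub>G\<^esub> \<in> U"
    using topspace_eq unfolding smooth_atlas_def by (metis (no_types, lifting) UN_E one_closed prod.collapse split_beta)
  have "chart_on T (U, \<phi>)" using atlas chart unfolding smooth_atlas_def by blast
  then have U: "openin T U" and homeo: "homeomorphic_map (subtopology T U) (top_of_set (\<phi> ` U)) \<phi>"
    by (auto simp: chart_on_def)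
  have UG: "U \<subseteq> carrier G" using openin_subset[OF U] topspace_eq by simp
  have inj: "inj_on \<phi> U"
    using homeomorphic_imp_injective_map[OF homeo] UG topspace_eq by (simp add: Int_absorb1)
  let ?\<psi> = "inv_into U \<phi>"
  have \<psi>: "?\<psi> (\<phi> g) = g" if "g \<in> U" for g using inj that by (rule inv_into_f_f)
  define p where "p = \<phi> \<one>\<^bsub>G\<^esub>"
  define S where "S = {(x, y). x \<in> \<phi> ` U \<and> y \<in> \<phi> ` U \<and> ?\<psi> x \<otimes>\<^bsub>G\<^esub> ?\<psi> y \<in> U}"
  define F where "F = (\<lambda>(x, y). \<phi> (?\<psi> x \<otimes>\<^bsub>G\<^esub> ?\<psi> y))"
  have smooth: "smooth_over (\<lambda>c. map_prod (s c) (s c)) s S F"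
    using lie chart unfolding lie_group_over_def S_def F_def by fast
  have "(p, p) \<in> S" using eU by (simp add: S_def p_def \<psi>)
  have scalars2: "map_prod (s (of_real r)) (s (of_real r)) v = r *\<^sub>R v" for r v
    by (cases v) (simp add: scalars)
  from smooth_over_imp_continuously_differentiable[OF smooth \<open>(p, p) \<in> S\<close> scalars2 scalars]
  obtain F' where deriv: "\<And>z. z \<in> S \<Longrightarrow> (F has_derivative F' z) (at z)"
    and cont: "\<And>e. e > 0 \<Longrightarrow> \<exists>d>0. \<forall>z. norm (z - (p, p)) < d \<longrightarrow>
      z \<in> S \<and> (\<forall>v. norm (F' z v - F' (p, p) v) \<le> e * norm v)"
    by blast
  have unit_right: "F (x, p) = x" and unit_left: "F (p, x) = x" if "x \<in> \<phi> ` U" for x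
    using that eU UG by (auto simp: F_def p_def \<psi>)
  obtain R where R: "R > 0"
    and law: "\<And>x y. norm (x - p) < R \<Longrightarrow> norm (y - p) < R \<Longrightarrow>
        (x, y) \<in> S \<and> norm (F (x, y) - x - (y - p)) \<le> norm (y - p) / 2"
    using local_group_law_approx_addition[of p S F F'] unit_right unit_left deriv cont
    by (smt (verit) S_def case_prod_conv mem_Collect_eq)
  define N where "N g = norm (\<phi> g - p)" for g
  let ?A = "{g \<in> U. N g < R}"
  \<comment> \<open>The bound \<open>R / 2\<close> keeps the coordinate of \<open>g\<^bsup>m\<^esup>\<close> within \<open>3 * R / 4\<close> of \<open>p\<close>, where the next
    multiplication by \<open>g\<close> is still controlled.\<close>
  have power: "g [^]\<^bsub>G\<^esub> m \<in> U \<and> norm (\<phi> (g [^]\<^bsub>G\<^esub> m) - p - real m *\<^sub>R (\<phi> g - p)) \<le> real m * N g / 2"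
    if g: "g \<in> ?A" and "real m * N g \<le> R / 2" for g m
    using that(2)
  proof (induction m)
    case 0
    show ?case using eU by (simp add: p_def)
  next
    case (Suc m)
    have "real m * N g \<le> real (Suc m) * N g" by (simp add: N_def mult_right_mono)
    with Suc.prems have small: "real m * N g \<le> R / 2" by linarith
    let ?x = "\<phi> (g [^]\<^bsub>G\<^esub> m)"
    have IH: "g [^]\<^bsub>G\<^esub> m \<in> U" "norm (?x - p - real m *\<^sub>R (\<phi> g - p)) \<le> real m * N g / 2"
      using Suc.IH[OF small] by auto
    have "norm (?x - p) \<le> norm (?x - p - real m *\<^sub>R (\<phi> g - p)) + norm (real m *\<^sub>R (\<phi> g - p))"
      by (metis diff_add_cancel norm_triangle_ineq)
    also have "\<dots> \<le> real m * N g / 2 + real m * N g" using IH by (simp add: N_def)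
    also have "\<dots> < R" using small R by linarith
    finally have "norm (?x - p) < R" .
    from law[OF this, of "\<phi> g"] g have
      S: "(?x, \<phi> g) \<in> S" and est: "norm (F (?x, \<phi> g) - ?x - (\<phi> g - p)) \<le> N g / 2"
      by (auto simp: N_def)
    have F: "F (?x, \<phi> g) = \<phi> (g [^]\<^bsub>G\<^esub> Suc m)" using g IH by (simp add: F_def \<psi>)
    have "norm (\<phi> (g [^]\<^bsub>G\<^esub> Suc m) - p - real (Suc m) *\<^sub>R (\<phi> g - p))
        = norm ((?x - p - real m *\<^sub>R (\<phi> g - p)) + (F (?x, \<phi> g) - ?x - (\<phi> g - p)))"
      unfolding F by (simp add: algebra_simps)
    also have "\<dots> \<le> real m * N g / 2 + N g / 2"
      using IH est by (intro norm_triangle_mono)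
    also have "\<dots> = real (Suc m) * N g / 2" by (simp add: field_simps)
    finally show ?case using S g IH by (simp add: S_def \<psi>)
  qed
  show ?thesis
  proof (rule NSS_of_linear_power_growth[OF group_axioms n_mono n_0 ratio, where A = ?A and N = N and R = "R / 2" and K = 2])
    fix r :: real assume r: "r > 0"
    have "openin (subtopology T U) {g \<in> topspace (subtopology T U). \<phi> g \<in> \<phi> ` U \<inter> ball p (min R r)}"
      using homeomorphic_imp_continuous_map[OF homeo]
      by (rule openin_continuous_map_preimage) (auto intro: openin_open_Int)
    also have "{g \<in> topspace (subtopology T U). \<phi> g \<in> \<phi> ` U \<inter> ball p (min R r)} = {g \<in> ?A. N g < r}"
      using UG topspace_eq by (auto simp: N_def dist_norm norm_minus_commute)
    finally have "openin T {g \<in> ?A. N g < r}" using U by (simp add: openin_open_subtopology)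
    moreover have "\<one>\<^bsub>G\<^esub> \<in> {g \<in> ?A. N g < r}" using eU r R by (simp add: N_def p_def)
    ultimately show "is_nbhd T \<one>\<^bsub>G\<^esub> {g \<in> ?A. N g < r}"
      using openin_subset unfolding is_nbhd_def by blast
  next
    fix g assume "g \<in> ?A" "N g = 0"
    then show "g = \<one>\<^bsub>G\<^esub>" using inj eU by (auto simp: N_def p_def inj_on_def)
  next
    fix g m assume g: "g \<in> ?A" and m: "real m * N g \<le> R / 2"
    have "norm (real m *\<^sub>R (\<phi> g - p)) \<le> norm (\<phi> (g [^]\<^bsub>G\<^esub> m) - p)
        + norm (\<phi> (g [^]\<^bsub>G\<^esub> m) - p - real m *\<^sub>R (\<phi> g - p))"
      by (metis norm_minus_commute norm_triangle_sub)
    then show "real m * N g \<le> 2 * N (g [^]\<^bsub>G\<^esub> m)"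
      using power[OF g m] by (simp add: N_def)
  qed (use R UG in \<open>auto simp: N_def\<close>)
qed


section \<open>Words in groups and short products near powers\<close>

lemma sum_list_exceeds_split:
  fixes w :: "'a \<Rightarrow> real"
  assumes "sum_list (map w xs) > u" and "u \<ge> 0"
  shows "\<exists>ys y zs. xs = ys @ y # zs \<and> sum_list (map w ys) \<le> u \<and> sum_list (map w ys) + w y > u"
  using assms(1)
proof (induction xs rule: rev_induct)
  case Nil
  then show ?case using assms(2) by simp
next
  case (snoc x xs)
  show ?case
  proof (cases "sum_list (map w xs) \<le> u")
    case True
    then show ?thesis using snoc.prems by (intro exI[of _ xs] exI[of _ x] exI[of _ "[]"]) simp
  next
    case False
    then obtain ys y zs where "xs = ys @ y # zs" "sum_list (map w ys) \<le> u" "sum_list (map w ys) + w y > u"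
      using snoc.IH by auto
    then show ?thesis by (intro exI[of _ ys] exI[of _ y] exI[of _ "zs @ [x]"]) simp
  qed
qed

text \<open>Greedy cutting: the longest initial block of weight at most \<open>u\<close>, together with the next letter,
  weighs more than \<open>u\<close>. Each such pair of blocks thus uses up one of the \<open>q\<close> units of weight; the last block
  accounts for the \<open>+ 1\<close>.\<close>

lemma light_blocks:
  fixes w :: "'a \<Rightarrow> real"
  assumes "u \<ge> 0" and "\<And>x. x \<in> set xs \<Longrightarrow> w x \<le> u" and "sum_list (map w xs) \<le> real q * u"
  shows "\<exists>bs. concat bs = xs \<and> length bs \<le> 2 * q + 1 \<and> (\<forall>b\<in>set bs. sum_list (map w b) \<le> u)"
  using assms(2,3)
proof (induction q arbitrary: xs)
  case 0
  then show ?case using assms(1) by (intro exI[of _ "[xs]"]) simp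
next
  case (Suc q)
  show ?case
  proof (cases "sum_list (map w xs) \<le> u")
    case True
    then show ?thesis by (intro exI[of _ "[xs]"]) simp
  next
    case False
    then obtain ys y zs where xs: "xs = ys @ y # zs"
      and ys: "sum_list (map w ys) \<le> u" "sum_list (map w ys) + w y > u"
      using sum_list_exceeds_split[of u w xs] assms(1) by auto
    have "sum_list (map w zs) \<le> real q * u"
      using Suc.prems(2) ys by (simp add: xs algebra_simps)
    with Suc.IH[of zs] Suc.prems(1) xs obtain bs where "concat bs = zs" "length bs \<le> 2 * q + 1"
      "\<forall>b\<in>set bs. sum_list (map w b) \<le> u" by auto
    then show ?thesis
      using xs ys(1) Suc.prems(1) by (intro exI[of _ "ys # [y] # bs"]) simp
  qed
qed

context group
begin

definition word_value :: "'a list \<Rightarrow> 'a" where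
  "word_value xs = foldr (\<otimes>) xs \<one>"

lemma word_value_simps [simp]:
  "word_value [] = \<one>" "word_value (x # xs) = x \<otimes> word_value xs"
  by (simp_all add: word_value_def)

lemma word_value_closed [simp]: "set xs \<subseteq> carrier G \<Longrightarrow> word_value xs \<in> carrier G"
  by (induction xs) auto

lemma word_value_append:
  "set xs \<subseteq> carrier G \<Longrightarrow> set ys \<subseteq> carrier G \<Longrightarrow> word_value (xs @ ys) = word_value xs \<otimes> word_value ys"
  by (induction xs) (auto simp: m_assoc)

lemma word_value_concat:
  "(\<And>b. b \<in> set bs \<Longrightarrow> set b \<subseteq> carrier G) \<Longrightarrow> word_value (concat bs) = word_value (map word_value bs)"
  by (induction bs) (auto simp: word_value_append UN_subset_iff)

lemma word_value_rev_inv: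
  "set xs \<subseteq> carrier G \<Longrightarrow> word_value (map (\<lambda>x. inv x) (rev xs)) = inv (word_value xs)"
proof (induction xs)
  case (Cons x xs)
  moreover from Cons have "set (map (\<lambda>x. inv x) (rev xs)) \<subseteq> carrier G" by auto
  ultimately show ?case by (simp add: word_value_append inv_mult_group)
qed simp

end

context topological_group
begin

lemma openin_carrier: "openin T (carrier G)"
  using openin_topspace topspace_eq by metis

lemma openin_subset_carrier: "openin T U \<Longrightarrow> U \<subseteq> carrier G"
  using openin_subset topspace_eq by metis

lemma openin_translate:
  assumes U: "openin T U" and a: "a \<in> carrier G"
  shows "openin T {y \<in> carrier G. a \<otimes> y \<in> U}"
proof -
  have "continuous_map T (prod_topology T T) (\<lambda>y. (a, y))"
    using a topspace_eq by (intro continuous_map_pairedI) auto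
  from continuous_map_compose[OF this continuous_mult]
  have "continuous_map T T (\<lambda>y. a \<otimes> y)" by (simp add: o_def)
  from openin_continuous_map_preimage[OF this U] show ?thesis by (simp add: topspace_eq)
qed

lemma openin_inv:
  assumes U: "openin T U"
  shows "openin T {y \<in> carrier G. inv y \<in> U}"
  using openin_continuous_map_preimage[OF continuous_inv U] by (simp add: topspace_eq)

text \<open>A short product of elements near \<open>g\<^bsup>-1\<^esup>\<close>, \<open>\<one>\<close> or \<open>g\<close> is near a power of \<open>g\<close> with exponent bounded by the
  length. For a fixed bound on the length, continuity makes this uniform, by Wallace's theorem applied to
  the finite (hence compact) sets \<open>{g\<^bsup>i\<^esup> | \<bar>i\<bar> \<le> j}\<close>. Noncommutativity does no harm, since the neighbourhood is
  chosen after \<open>g\<close> and the length.\<close>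

lemma ex_symmetric_nbhd_with_short_words_in:
  fixes m :: nat
  assumes g: "g \<in> carrier G" and U: "openin T U"
    and powers: "(\<lambda>i::int. g [^] i) ` {- int m..int m} \<subseteq> U"
  shows "\<exists>W. openin T W \<and> \<one> \<in> W \<and> g \<in> W \<and> (\<forall>x\<in>W. inv x \<in> W) \<and>
    (\<forall>xs. set xs \<subseteq> W \<and> length xs \<le> m \<longrightarrow> word_value xs \<in> U)"
proof -
  let ?P = "\<lambda>m. (\<lambda>i::int. g [^] i) ` {- int m..int m}"
  have P1: "?P 1 = {inv g, \<one>, g}"
  proof -
    have "{- int 1..int 1} = {-1, 0, 1}" by auto
    then show ?thesis using g int_pow_neg[of g 1] by auto
  qed
  have nbhd: "?P m \<subseteq> U \<Longrightarrow> \<exists>W. openin T W \<and> ?P 1 \<subseteq> W \<and>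
    (\<forall>xs. set xs \<subseteq> W \<and> length xs \<le> m \<longrightarrow> word_value xs \<in> U)"
    using U
  proof (induction m arbitrary: U)
    case 0
    have "?P 1 \<subseteq> carrier G" using g by auto
    then show ?case using 0 openin_carrier by auto
  next
    case (Suc m)
    let ?M = "{z \<in> topspace (prod_topology T T). (\<lambda>(x, y). x \<otimes> y) z \<in> U}"
    have M: "openin (prod_topology T T) ?M"
      using openin_continuous_map_preimage[OF continuous_mult Suc.prems(2)] .
    have sub: "?P 1 \<times> ?P m \<subseteq> ?M"
    proof -
      have "(g [^] i) \<otimes> (g [^] j) \<in> U" if "i \<in> {- int 1..int 1}" "j \<in> {- int m..int m}" for i j
      proof -
        have "i + j \<in> {- int (Suc m)..int (Suc m)}" using that by auto
        then have "g [^] (i + j) \<in> U" using Suc.prems(1) by blast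
        then show ?thesis using g by (simp add: int_pow_mult)
      qed
      then show ?thesis using g topspace_eq by auto
    qed
    have compact: "compactin T (?P j)" for j
      using g topspace_eq by (intro finite_imp_compactin) auto
    obtain A B where A: "openin T A" "?P 1 \<subseteq> A" and B: "openin T B" "?P m \<subseteq> B"
      and AB: "A \<times> B \<subseteq> ?M"
      by (rule Wallace_theorem_prod_topology[OF compact compact M sub])
    from Suc.IH[OF B(2,1)] obtain W where W: "openin T W" "?P 1 \<subseteq> W"
      and words: "\<And>xs. set xs \<subseteq> W \<Longrightarrow> length xs \<le> m \<Longrightarrow> word_value xs \<in> B" by blast
    show ?case
    proof (intro exI[of _ "A \<inter> W"] conjI allI impI)
      show "openin T (A \<inter> W)" using A W by blast
      show "?P 1 \<subseteq> A \<inter> W" using A W by blast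
      fix xs assume xs: "set xs \<subseteq> A \<inter> W \<and> length xs \<le> Suc m"
      show "word_value xs \<in> U"
      proof (cases xs)
        case Nil
        have "g [^] (0::int) \<in> U" using Suc.prems(1) by (auto simp: image_subset_iff simp del: int_pow_0)
        then show ?thesis using Nil by simp
      next
        case (Cons x ys)
        then have "(x, word_value ys) \<in> A \<times> B" using xs words by auto
        then show ?thesis using AB Cons by auto
      qed
    qed
  qed
  from nbhd[OF powers] obtain W where W: "openin T W" "?P 1 \<subseteq> W"
    and words: "\<And>xs. set xs \<subseteq> W \<Longrightarrow> length xs \<le> m \<Longrightarrow> word_value xs \<in> U" by blast
  have WG: "W \<subseteq> carrier G" using W(1) by (rule openin_subset_carrier)
  let ?W = "W \<inter> {y \<in> carrier G. inv y \<in> W}"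
  have "openin T ?W" using W(1) openin_inv by blast
  moreover have "\<one> \<in> ?W" "g \<in> ?W" using W(2) g unfolding P1 by auto
  moreover have "\<forall>x\<in>?W. inv x \<in> ?W" using WG by auto
  ultimately show ?thesis using words by (intro exI[of _ ?W]) auto
qed

end


section \<open>The left-invariant metric of a chain of neighbourhoods\<close>

text \<open>A neighbourhood base at the unit in which \<open>V (Suc n)\<close> is so much smaller than \<open>V n\<close> that products of
  \<open>2 * k n + 1\<close> of its elements stay in \<open>V n\<close>. It gives rise to a left-invariant metric, in the manner of Birkhoff
  and Kakutani, which assigns length at most \<open>scale n\<close> to the elements of \<open>V n\<close>; this bound decreases by the full
  factor \<open>k n\<close> from \<open>V n\<close> to \<open>V (Suc n)\<close>. The more common chains with \<open>V (Suc n)\<^sup>3 \<subseteq> V n\<close> and lengths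
  \<open>2\<^bsup>-n\<^esup>\<close> would not do: of order \<open>log k\<close> steps are needed to make room for \<open>k\<close> factors, and they shorten the
  elements only by a power of \<open>k\<close> with exponent less than 1. Starting from
  \<open>V 0 = carrier G\<close> gives every element a finite length.\<close>

locale nbhd_chain = topological_group +
  fixes V :: "nat \<Rightarrow> 'a set" and k :: "nat \<Rightarrow> nat"
  assumes V_open: "openin T (V n)"
    and one_V: "\<one> \<in> V n"
    and inv_V: "x \<in> V n \<Longrightarrow> inv x \<in> V n"
    and V_0: "V 0 = carrier G"
    and k_ge_2: "k n \<ge> 2"
    and words_V: "set xs \<subseteq> V (Suc n) \<Longrightarrow> length xs \<le> 2 * k n + 1 \<Longrightarrow> word_value xs \<in> V n"
    and V_base: "openin T U \<Longrightarrow> \<one> \<in> U \<Longrightarrow> \<exists>n. V n \<subseteq> U"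
    and hausdorff: "(\<And>n. x \<in> V n) \<Longrightarrow> x = \<one>"
begin

definition scale :: "nat \<Rightarrow> real" where
  "scale n = (\<Prod>i<n. 1 / real (k i))"

lemma scale_0 [simp]: "scale 0 = 1"
  by (simp add: scale_def)

lemma scale_Suc: "scale (Suc n) = scale n / real (k n)"
  by (simp add: scale_def)

lemma scale_pos: "scale n > 0"
proof -
  have "k i > 0" for i using k_ge_2[of i] by linarith
  then show ?thesis unfolding scale_def by (intro prod_pos) simp
qed

lemma scale_Suc_le: "scale (Suc n) \<le> scale n / 2"
  unfolding scale_Suc using scale_pos[of n] k_ge_2[of n] by (intro divide_left_mono) auto

lemma scale_le: "scale n \<le> (1/2) ^ n"
proof (induction n)
  case (Suc n)
  with scale_Suc_le[of n] show ?case by simp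
qed simp

lemma scale_strict_antimono:
  assumes "i < j"
  shows "scale j < scale i"
proof -
  have "- scale n < - scale (Suc n)" for n using scale_Suc_le[of n] scale_pos[of n] by simp
  from lift_Suc_mono_less[of "\<lambda>n. - scale n", OF this assms] show ?thesis by simp
qed

lemma scale_less_iff: "scale i < scale j \<longleftrightarrow> j < i"
  using scale_strict_antimono by (metis less_asym linorder_neqE_nat less_irrefl)

lemma scale_small:
  assumes "e > 0"
  shows "\<exists>n. scale n < e"
proof -
  obtain n where "(1/2) ^ n < e" using real_arch_pow_inv[OF assms, of "1/2"] by auto
  with scale_le[of n] show ?thesis by (intro exI[of _ n]) linarith
qed

lemma V_subset_carrier: "V n \<subseteq> carrier G"
  using V_open by (rule openin_subset_carrier)

lemma V_carrier: "x \<in> V n \<Longrightarrow> x \<in> carrier G"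
  using V_subset_carrier by blast

lemma V_antimono: "m \<le> n \<Longrightarrow> V n \<subseteq> V m"
proof (rule lift_Suc_antimono_le)
  show "V (Suc n) \<subseteq> V n" for n
  proof
    fix x assume "x \<in> V (Suc n)"
    then show "x \<in> V n" using words_V[of "[x]" n] V_carrier[of x "Suc n"] by simp
  qed
qed

text \<open>The label \<open>a\<close> of a letter \<open>(x, a)\<close> witnesses \<open>x \<in> V a\<close> and sets its price \<open>scale a\<close>.\<close>

definition admissible :: "('a \<times> nat) list \<Rightarrow> bool" where
  "admissible ws \<longleftrightarrow> (\<forall>(x, a)\<in>set ws. x \<in> V a)"

definition weight :: "('a \<times> nat) list \<Rightarrow> real" where
  "weight ws = sum_list (map (\<lambda>(x, a). scale a) ws)"

definition val :: "('a \<times> nat) list \<Rightarrow> 'a" where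
  "val ws = word_value (map fst ws)"

lemma admissible_carrier: "admissible ws \<Longrightarrow> set (map fst ws) \<subseteq> carrier G"
  using V_subset_carrier by (fastforce simp: admissible_def)

lemma weight_nonneg: "weight ws \<ge> 0"
  unfolding weight_def by (rule sum_list_nonneg) (auto intro: less_imp_le scale_pos)

text \<open>The chain is recovered from the weights. Let \<open>n'\<close> be the finest scale that bounds the weight of the
  word. Either the word is a single letter of weight \<open>scale n'\<close>, or all letters weigh at most
  \<open>scale (Suc n')\<close>; then greedy cutting gives at most \<open>2 * k n' + 1\<close> blocks of weight at most \<open>scale (Suc n')\<close>.
  By maximality of \<open>n'\<close> they are proper subwords, so induction puts their values into \<open>V (Suc n')\<close>.\<close>

lemma light_word_in_V:
  assumes "admissible ws" and "weight ws \<le> scale n"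
  shows "val ws \<in> V n"
  using assms
proof (induction "length ws" arbitrary: ws n rule: less_induct)
  case less
  show ?case
  proof (cases "ws = []")
    case True
    then show ?thesis by (simp add: val_def one_V)
  next
    case False
    then obtain y ys where "ws = y # ys" by (cases ws) auto
    then have pos: "weight ws > 0"
      using scale_pos[of "snd y"] weight_nonneg[of ys] by (simp add: weight_def split_beta)
    then obtain l where "scale l < weight ws" using scale_small by blast
    define l0 where "l0 = (LEAST l. scale l < weight ws)"
    have l0: "scale l0 < weight ws" unfolding l0_def using \<open>scale l < _\<close> by (rule LeastI)
    have "n < l0" using l0 less.prems(2) scale_less_iff[of l0 n] by linarith
    then obtain n' where n': "l0 = Suc n'" "n \<le> n'" by (cases l0) auto
    have upper: "weight ws \<le> scale n'"
      using not_less_Least[of n' "\<lambda>l. scale l < weight ws"] n' unfolding l0_def[symmetric] by simp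
    have lower: "weight ws > scale (Suc n')" using l0 n' by simp
    have "val ws \<in> V n'"
    proof (cases "\<exists>x. (x, n') \<in> set ws")
      case True
      then obtain x ys zs where ws: "ws = ys @ (x, n') # zs" by (auto dest: split_list)
      have "weight ys + weight zs \<le> 0" using upper by (simp add: ws weight_def)
      moreover have "weight ys > 0" if "ys \<noteq> []" for ys
        using that scale_pos weight_nonneg by (cases ys) (auto simp: weight_def add_pos_nonneg)
      ultimately have "ys = []" "zs = []"
        using weight_nonneg[of ys] weight_nonneg[of zs] by force+
      then show ?thesis using less.prems(1) V_carrier[of x n'] by (simp add: ws val_def admissible_def)
    next
      case False
      have light: "scale a \<le> scale (Suc n')" if "(x, a) \<in> set ws" for x a
      proof -
        have "scale a \<le> weight ws"
          unfolding weight_def using that scale_pos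
          by (intro member_le_sum_list) (force simp: image_iff less_imp_le)+
        then have "scale a \<le> scale n'" using upper by simp
        then have "n' \<le> a" using scale_less_iff[of n' a] by linarith
        moreover have "a \<noteq> n'" using False that by auto
        ultimately show ?thesis using scale_less_iff[of "Suc n'" a] by linarith
      qed
      have "weight ws \<le> real (k n') * scale (Suc n')"
        using upper k_ge_2[of n'] by (simp add: scale_Suc)
      then obtain bs where bs: "concat bs = ws" "length bs \<le> 2 * k n' + 1"
        and blocks: "\<And>b. b \<in> set bs \<Longrightarrow> weight b \<le> scale (Suc n')"
        using light_blocks[of "scale (Suc n')" ws "\<lambda>(x, a). scale a" "k n'"] light scale_pos[of "Suc n'"]
        unfolding weight_def by fastforce
      have adm: "admissible b" if "b \<in> set bs" for b
        using less.prems(1) that bs(1) by (auto simp: admissible_def)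
      have "val b \<in> V (Suc n')" if b: "b \<in> set bs" for b
      proof (rule less.hyps)
        obtain as cs where as: "bs = as @ b # cs" using b by (auto dest: split_list)
        show "length b < length ws"
        proof (rule ccontr)
          assume "\<not> length b < length ws"
          moreover have split: "ws = concat as @ b @ concat cs" unfolding bs(1)[symmetric] as by simp
          ultimately have "length (concat as) = 0" "length (concat cs) = 0" by simp_all
          then have "ws = b" using split by (simp del: concat_eq_Nil_conv)
          then show False using blocks[OF b] lower by simp
        qed
      qed (use adm b blocks in auto)
      then have "word_value (map val bs) \<in> V n'"
        using bs(2) by (intro words_V) auto
      moreover have "val ws = word_value (map val bs)"
        unfolding val_def bs(1)[symmetric] map_concat
        using adm admissible_carrier by (subst word_value_concat) (fastforce simp: o_def val_def)+
      ultimately show ?thesis by simp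
    qed
    then show ?thesis using V_antimono[OF n'(2)] by blast
  qed
qed

definition chain_norm :: "'a \<Rightarrow> real" where
  "chain_norm f = Inf {weight ws | ws. admissible ws \<and> val ws = f}"

lemma chain_norm_le: "admissible ws \<Longrightarrow> chain_norm (val ws) \<le> weight ws"
  unfolding chain_norm_def using weight_nonneg by (intro cInf_lower bdd_belowI[of _ 0]) auto

lemma ex_word:
  assumes "f \<in> carrier G" and "chain_norm f < r"
  obtains ws where "admissible ws" "val ws = f" "weight ws < r"
proof -
  have "admissible [(f, 0)]" "val [(f, 0)] = f"
    using assms(1) by (auto simp: admissible_def V_0 val_def)
  then have "{weight ws | ws. admissible ws \<and> val ws = f} \<noteq> {}" by blast
  from cInf_lessD[OF this assms(2)[unfolded chain_norm_def]] show ?thesis using that by blast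
qed

lemma chain_norm_nonneg: "f \<in> carrier G \<Longrightarrow> chain_norm f \<ge> 0"
  using ex_word[of f 0] weight_nonneg by (metis not_le)

lemma chain_norm_le_scale: "x \<in> V n \<Longrightarrow> chain_norm x \<le> scale n"
  using chain_norm_le[of "[(x, n)]"] V_carrier[of x n] by (simp add: admissible_def weight_def val_def)

lemma chain_norm_less_scale: "x \<in> carrier G \<Longrightarrow> chain_norm x < scale n \<Longrightarrow> x \<in> V n"
  by (metis ex_word light_word_in_V less_imp_le)

lemma chain_norm_one: "chain_norm \<one> = 0"
  using chain_norm_le[of "[]"] chain_norm_nonneg[of \<one>] by (simp add: admissible_def weight_def val_def)

lemma chain_norm_mult:
  assumes "x \<in> carrier G" "y \<in> carrier G"
  shows "chain_norm (x \<otimes> y) \<le> chain_norm x + chain_norm y"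
proof (rule field_le_epsilon)
  fix e :: real assume e: "e > 0"
  obtain xs where xs: "admissible xs" "val xs = x" "weight xs < chain_norm x + e / 2"
    using ex_word[of x "chain_norm x + e / 2"] assms e by auto
  obtain ys where ys: "admissible ys" "val ys = y" "weight ys < chain_norm y + e / 2"
    using ex_word[of y "chain_norm y + e / 2"] assms e by auto
  have "admissible (xs @ ys)" using xs ys by (auto simp: admissible_def)
  moreover have "val (xs @ ys) = x \<otimes> y"
    using xs ys admissible_carrier by (simp add: val_def word_value_append)
  ultimately have "chain_norm (x \<otimes> y) \<le> weight (xs @ ys)" using chain_norm_le by metis
  then show "chain_norm (x \<otimes> y) \<le> chain_norm x + chain_norm y + e"
    using xs(3) ys(3) by (simp add: weight_def)
qed

lemma chain_norm_inv_le:
  assumes "x \<in> carrier G"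
  shows "chain_norm (inv x) \<le> chain_norm x"
proof (rule field_le_epsilon)
  fix e :: real assume e: "e > 0"
  obtain xs where xs: "admissible xs" "val xs = x" "weight xs < chain_norm x + e"
    using ex_word[of x "chain_norm x + e"] assms e by auto
  let ?ys = "map (\<lambda>(x, a). (inv x, a)) (rev xs)"
  have "admissible ?ys" using xs inv_V by (auto simp: admissible_def)
  moreover have "val ?ys = inv x"
  proof -
    have "map fst ?ys = map (\<lambda>x. inv x) (rev (map fst xs))"
      by (simp add: rev_map o_def split_beta)
    then show ?thesis using xs admissible_carrier by (simp only: val_def word_value_rev_inv)
  qed
  moreover have "weight ?ys = weight xs"
    by (simp add: weight_def o_def case_prod_unfold flip: rev_map)
  ultimately show "chain_norm (inv x) \<le> chain_norm x + e" using chain_norm_le xs(3) by fastforce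
qed

lemma chain_norm_inv: "x \<in> carrier G \<Longrightarrow> chain_norm (inv x) = chain_norm x"
  using chain_norm_inv_le[of x] chain_norm_inv_le[of "inv x"] by simp

lemma chain_norm_eq_0: "x \<in> carrier G \<Longrightarrow> chain_norm x = 0 \<Longrightarrow> x = \<one>"
  using hausdorff chain_norm_less_scale scale_pos by simp

text \<open>The value off the carrier makes symmetry and nonnegativity hold everywhere, as
  \<^locale>\<open>Metric_space\<close> demands.\<close>

definition chain_dist :: "'a \<Rightarrow> 'a \<Rightarrow> real" where
  "chain_dist x y = (if x \<in> carrier G \<and> y \<in> carrier G then chain_norm (inv x \<otimes> y) else 0)"

lemma Metric_space_chain_dist: "Metric_space (carrier G) chain_dist"
proof
  show "0 \<le> chain_dist x y" for x y by (simp add: chain_dist_def chain_norm_nonneg)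
  show "chain_dist x y = chain_dist y x" for x y
    using chain_norm_inv[of "inv x \<otimes> y"] by (auto simp: chain_dist_def inv_mult_group)
  show "chain_dist x y = 0 \<longleftrightarrow> x = y" if "x \<in> carrier G" "y \<in> carrier G" for x y
  proof
    assume "chain_dist x y = 0"
    then have "inv x \<otimes> y = \<one>" using that chain_norm_eq_0[of "inv x \<otimes> y"] by (simp add: chain_dist_def)
    then have "x \<otimes> (inv x \<otimes> y) = x" using that by simp
    then show "x = y" using that by (simp add: m_assoc[symmetric])
  qed (use that chain_norm_one in \<open>simp add: chain_dist_def\<close>)
  show "chain_dist x z \<le> chain_dist x y + chain_dist y z"
    if "x \<in> carrier G" "y \<in> carrier G" "z \<in> carrier G" for x y z
  proof -
    have "inv x \<otimes> z = (inv x \<otimes> y) \<otimes> (inv y \<otimes> z)"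
      using that by (simp add: m_assoc) (simp add: m_assoc[symmetric])
    then show ?thesis using that chain_norm_mult[of "inv x \<otimes> y" "inv y \<otimes> z"] by (simp add: chain_dist_def)
  qed
qed

lemma chain_dist_left_invariant:
  "h \<in> carrier G \<Longrightarrow> g \<in> carrier G \<Longrightarrow> f \<in> carrier G \<Longrightarrow>
    chain_dist (h \<otimes> g) (h \<otimes> f) = chain_dist g f"
  by (simp add: chain_dist_def inv_mult_group m_assoc inv_solve_left flip: m_assoc[of "inv h" h])

lemma mtopology_chain_dist: "Metric_space.mtopology (carrier G) chain_dist = T"
proof -
  interpret D: Metric_space "carrier G" chain_dist by (rule Metric_space_chain_dist)
  have "openin D.mtopology U \<longleftrightarrow> openin T U" for U
  proof
    assume U: "openin D.mtopology U"
    show "openin T U"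
    proof (subst openin_subopen, intro ballI)
      fix x assume x: "x \<in> U"
      then have xG: "x \<in> carrier G" using U D.openin_mtopology by blast
      obtain r where r: "r > 0" "D.mball x r \<subseteq> U" using U x D.openin_mtopology by blast
      obtain n where n: "scale n < r" using scale_small r by blast
      let ?B = "{y \<in> carrier G. inv x \<otimes> y \<in> V n}"
      have "openin T ?B" using openin_translate[OF V_open] xG by simp
      moreover have "x \<in> ?B" using xG one_V by simp
      moreover have "?B \<subseteq> D.mball x r"
        using xG chain_norm_le_scale n by (force simp: chain_dist_def)
      ultimately show "\<exists>B. openin T B \<and> x \<in> B \<and> B \<subseteq> U" using r(2) by blast
    qed
  next
    assume U: "openin T U"
    have UG: "U \<subseteq> carrier G" using U by (rule openin_subset_carrier)
    show "openin D.mtopology U"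
      unfolding D.openin_mtopology
    proof (intro conjI UG allI impI)
      fix x assume x: "x \<in> U"
      then have xG: "x \<in> carrier G" using UG by blast
      have "openin T {y \<in> carrier G. x \<otimes> y \<in> U}" using openin_translate[OF U xG] .
      moreover have "\<one> \<in> {y \<in> carrier G. x \<otimes> y \<in> U}" using x xG by simp
      ultimately obtain n where n: "V n \<subseteq> {y \<in> carrier G. x \<otimes> y \<in> U}" using V_base by meson
      have "D.mball x (scale n) \<subseteq> U"
      proof
        fix y assume "y \<in> D.mball x (scale n)"
        then have y: "y \<in> carrier G" "chain_norm (inv x \<otimes> y) < scale n" using xG by (auto simp: chain_dist_def)
        then have "inv x \<otimes> y \<in> V n" using xG chain_norm_less_scale by simp
        then have "x \<otimes> (inv x \<otimes> y) \<in> U" using n by blast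
        then show "y \<in> U" using xG y by (simp add: m_assoc[symmetric])
      qed
      then show "\<exists>r>0. D.mball x r \<subseteq> U" using scale_pos by blast
    qed
  qed
  then show ?thesis by (simp add: topology_eq)
qed

end


section \<open>Groups with a minimal metric\<close>

text \<open>Write \<open>\<bar>g\<bar>\<close> for \<open>d g \<one>\<close>. If the claim fails, there are elements \<open>g\<close> all of whose powers up to an exponent slightly
  above \<open>2 / \<bar>g\<bar>\<close> are as small as desired. Having reached \<open>V n\<close>, pick \<open>g\<close> with these powers deep inside \<open>V n\<close>,
  put \<open>k n \<approx> 1 / \<bar>g\<bar>\<close> and let \<open>V (Suc n)\<close> be a neighbourhood of \<open>g\<close> and \<open>\<one>\<close> whose words of length \<open>2 * k n + 1\<close> stay
  in \<open>V n\<close>. For the metric of this chain, the length of \<open>g\<close> is at most \<open>scale n / k n \<le> scale n * \<bar>g\<bar>\<close>, and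
  \<open>scale n \<longlonglongrightarrow> 0\<close>: minimality of \<open>d\<close> is violated along a sequence converging to \<open>\<one>\<close>.\<close>

lemma minimal_metric_power_escape:
  fixes G :: "'g monoid"
  assumes G: "topological_group G T" and d: "minimal_metric G T d"
  shows "\<exists>\<epsilon>>0. \<forall>g\<in>carrier G. g \<noteq> \<one>\<^bsub>G\<^esub> \<longrightarrow>
    (\<exists>i\<le>2 * nat \<lceil>1 / d g \<one>\<^bsub>G\<^esub>\<rceil> + 1. d (g [^]\<^bsub>G\<^esub> i) \<one>\<^bsub>G\<^esub> \<ge> \<epsilon>)"
proof (rule ccontr)
  assume contra: "\<not> ?thesis"
  interpret topological_group G T by (rule G)
  have metric: "Metric_space (carrier G) d" and top: "Metric_space.mtopology (carrier G) d = T"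
    and left: "\<And>h g f. h \<in> carrier G \<Longrightarrow> g \<in> carrier G \<Longrightarrow> f \<in> carrier G \<Longrightarrow>
      d (h \<otimes>\<^bsub>G\<^esub> g) (h \<otimes>\<^bsub>G\<^esub> f) = d g f"
    using d by (auto simp: minimal_metric_def compatible_left_invariant_metric_def)
  interpret M: Metric_space "carrier G" d by (rule metric)
  let ?e = "\<one>\<^bsub>G\<^esub>"
  let ?m = "\<lambda>g. nat \<lceil>1 / d g ?e\<rceil>"
  have ball_in: "\<exists>r>0. M.mball ?e r \<subseteq> U" if "openin T U" "?e \<in> U" for U
    using that unfolding top[symmetric] M.openin_mtopology by simp
  have small_powers: "\<exists>g\<in>carrier G. g \<noteq> ?e \<and> (\<forall>i\<le>2 * ?m g + 1. d (g [^]\<^bsub>G\<^esub> i) ?e < \<epsilon>)"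
    if "\<epsilon> > 0" for \<epsilon>
    using contra that by (meson not_le)
  \<comment> \<open>The chain is built by dependent choice; a stage also carries the element \<open>g\<close> and the number \<open>k\<close> that
    link it to the previous stage.\<close>
  define good where "good V \<longleftrightarrow> openin T V \<and> ?e \<in> V \<and> (\<forall>x\<in>V. inv\<^bsub>G\<^esub> x \<in> V)" for V
  define P where "P n = (\<lambda>(V, g::'g, k::nat). good V \<and> (n = 0 \<longrightarrow> V = carrier G))" for n :: nat
  define Q where "Q n = (\<lambda>(V, g::'g, k::nat) (V', g', k').
    g' \<in> V' \<and> V' \<subseteq> M.mball ?e (1 / real (Suc n)) \<and> 2 \<le> k' \<and> 1 \<le> real k' * d g' ?e \<and>
    (\<forall>xs. set xs \<subseteq> V' \<longrightarrow> length xs \<le> 2 * k' + 1 \<longrightarrow> word_value xs \<in> V))" for n :: nat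
  have "\<exists>f. \<forall>n. P n (f n) \<and> Q n (f n) (f (Suc n))"
  proof (rule dependent_nat_choice)
    have "good (carrier G)" by (simp add: good_def openin_carrier)
    then show "\<exists>x. P 0 x" by (auto simp: P_def)
  next
    fix x n assume "P n x"
    then obtain V g0 k0 where x: "x = (V, g0, k0)" and V: "good V" by (auto simp: P_def)
    obtain r where r: "r > 0" "M.mball ?e r \<subseteq> V"
      using V ball_in[of V] unfolding good_def by meson
    \<comment> \<open>\<open>1 / Suc n\<close> makes the chain a neighbourhood base, and \<open>1/2\<close> forces \<open>k \<ge> 2\<close>.\<close>
    define \<epsilon> where "\<epsilon> = min r (min (1/2) (1 / real (Suc n)))"
    have \<epsilon>: "\<epsilon> \<le> r" "\<epsilon> \<le> 1/2" "\<epsilon> \<le> 1 / real (Suc n)" unfolding \<epsilon>_def by linarith+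
    have "\<epsilon> > 0" using r by (simp add: \<epsilon>_def)
    from small_powers[OF this] obtain g where g: "g \<in> carrier G" "g \<noteq> ?e"
      and small: "\<And>i. i \<le> 2 * ?m g + 1 \<Longrightarrow> d (g [^]\<^bsub>G\<^esub> i) ?e < \<epsilon>" by blast
    define m where "m = 2 * ?m g + 1"
    have dg: "d g ?e > 0" "d g ?e < 1/2"
      using g small[of 1] M.mdist_pos_eq[of g ?e] \<epsilon>(2) by auto
    have int_powers: "(\<lambda>i::int. g [^]\<^bsub>G\<^esub> i) ` {- int m..int m} \<subseteq> M.mball ?e \<epsilon>"
    proof (rule image_subsetI)
      fix i assume i: "i \<in> {- int m..int m}"
      show "g [^]\<^bsub>G\<^esub> i \<in> M.mball ?e \<epsilon>"
      proof (cases "i \<ge> 0")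
        case True
        then obtain j where j: "i = int j" using nonneg_int_cases by blast
        with i have "j \<le> m" by simp
        with small[of j] have "d (g [^]\<^bsub>G\<^esub> j) ?e < \<epsilon>" by (simp add: m_def)
        then show ?thesis using j g by (simp add: int_pow_int M.commute[of ?e])
      next
        case False
        then obtain j where j: "i = - int j" by (metis nonpos_int_cases linear)
        let ?h = "g [^]\<^bsub>G\<^esub> j"
        have "d (inv\<^bsub>G\<^esub> ?h) ?e = d ?e ?h"
          using left[of ?h "inv\<^bsub>G\<^esub> ?h" ?e] g by simp
        moreover from i j have "j \<le> m" by simp
        with small[of j] have "d ?h ?e < \<epsilon>" by (simp add: m_def)
        ultimately show ?thesis using j g by (simp add: int_pow_neg_int M.commute[of ?e])
      qed
    qed
    have "openin T (M.mball ?e \<epsilon>)" using M.openin_mball top by metis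
    from ex_symmetric_nbhd_with_short_words_in[OF g(1) this int_powers]
    obtain W where W: "good W" "g \<in> W" and words_all:
      "\<forall>xs. set xs \<subseteq> W \<and> length xs \<le> m \<longrightarrow> word_value xs \<in> M.mball ?e \<epsilon>"
      by (elim exE conjE) (rule that; simp add: good_def)
    have words: "word_value xs \<in> M.mball ?e \<epsilon>" if "set xs \<subseteq> W" "length xs \<le> m" for xs
      using words_all that by blast
    have W_ball: "W \<subseteq> M.mball ?e \<epsilon>"
    proof
      fix y assume y: "y \<in> W"
      then have "y \<in> carrier G" using W(1) openin_subset_carrier unfolding good_def by blast
      then show "y \<in> M.mball ?e \<epsilon>" using words[of "[y]"] y by (simp add: m_def)
    qed
    have "real (?m g) \<ge> 1 / d g ?e" by (simp add: real_nat_ceiling_ge)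
    then have k: "1 \<le> real (?m g) * d g ?e" by (simp only: pos_divide_le_eq[OF dg(1)])
    have "2 < 1 / d g ?e" using dg by (simp add: field_simps)
    with \<open>real (?m g) \<ge> 1 / d g ?e\<close> have "2 \<le> ?m g" by linarith
    have "P (Suc n) (W, g, ?m g)" using W by (simp add: P_def)
    moreover have "Q n x (W, g, ?m g)"
      unfolding x Q_def prod.case
    proof (intro conjI allI impI W k)
      show "W \<subseteq> M.mball ?e (1 / real (Suc n))"
        using W_ball M.mball_subset_concentric[OF \<epsilon>(3)] by blast
      show "word_value xs \<in> V" if "set xs \<subseteq> W" "length xs \<le> 2 * ?m g + 1" for xs
        using words[of xs] that r(2) M.mball_subset_concentric[OF \<epsilon>(1)] unfolding m_def by blast
    qed fact
    ultimately show "\<exists>y. P (Suc n) y \<and> Q n x y" by blast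
  qed
  then obtain f where f: "\<And>n. P n (f n)" "\<And>n. Q n (f n) (f (Suc n))" by blast
  define V where "V n = fst (f n)" for n
  define g where "g n = fst (snd (f (Suc n)))" for n
  define k where "k n = snd (snd (f (Suc n)))" for n
  have V: "good (V n)" "V 0 = carrier G" for n
    using f(1)[of n] f(1)[of 0] by (auto simp: P_def V_def split: prod.splits)
  have g_V: "g n \<in> V (Suc n)" and V_ball: "V (Suc n) \<subseteq> M.mball ?e (1 / real (Suc n))"
    and k_2: "2 \<le> k n" and k_g: "1 \<le> real (k n) * d (g n) ?e"
    and words: "set xs \<subseteq> V (Suc n) \<Longrightarrow> length xs \<le> 2 * k n + 1 \<Longrightarrow> word_value xs \<in> V n" for n xs
    using f(2)[of n] by (auto simp: Q_def V_def g_def k_def split_beta)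
  interpret C: nbhd_chain G T V k
  proof
    show "openin T (V n)" "?e \<in> V n" "x \<in> V n \<Longrightarrow> inv\<^bsub>G\<^esub> x \<in> V n" "V 0 = carrier G" for n x
      using V by (auto simp: good_def)
    show "2 \<le> k n" for n by (rule k_2)
    show "set xs \<subseteq> V (Suc n) \<Longrightarrow> length xs \<le> 2 * k n + 1 \<Longrightarrow> word_value xs \<in> V n" for xs n
      by (rule words)
    show "\<exists>n. V n \<subseteq> U" if "openin T U" "?e \<in> U" for U
    proof -
      from ball_in[OF that] obtain r where r: "r > 0" "M.mball ?e r \<subseteq> U" by blast
      obtain n where "1 / real (Suc n) < r" using nat_approx_posE[OF r(1)] by metis
      then have "V (Suc n) \<subseteq> U"
        using V_ball[of n] M.mball_subset_concentric[of "1 / real (Suc n)" r ?e] r(2) by (meson less_imp_le order_trans)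
      then show ?thesis by blast
    qed
    show "x = ?e" if x: "\<And>n. x \<in> V n" for x
    proof (rule ccontr)
      assume "x \<noteq> ?e"
      have xG: "x \<in> carrier G" using x[of 0] V by simp
      with \<open>x \<noteq> ?e\<close> have "d ?e x > 0" using M.mdist_pos_eq[of ?e x] by auto
      then obtain n where "1 / real (Suc n) < d ?e x" using nat_approx_posE by metis
      moreover have "d ?e x < 1 / real (Suc n)" using V_ball[of n] x[of "Suc n"] by auto
      ultimately show False by simp
    qed
  qed
  have "compatible_left_invariant_metric G T C.chain_dist"
    unfolding compatible_left_invariant_metric_def
    using C.Metric_space_chain_dist C.mtopology_chain_dist C.chain_dist_left_invariant by blast
  then obtain U K where U: "is_nbhd T ?e U" and K: "K > 0"
    and dom: "\<And>x y. x \<in> U \<Longrightarrow> y \<in> U \<Longrightarrow> d x y \<le> K * C.chain_dist x y"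
    using d unfolding minimal_metric_def by meson
  obtain O' where O': "openin T O'" "?e \<in> O'" "O' \<subseteq> U" using U unfolding is_nbhd_def by blast
  obtain n0 where n0: "V n0 \<subseteq> O'" using C.V_base[OF O'(1,2)] by blast
  obtain n1 where n1: "C.scale n1 < 1 / K" using C.scale_small[of "1 / K"] K by auto
  define n where "n = max n0 n1"
  have k_pos: "real (k n) > 0" using k_2[of n] by linarith
  have gn: "g n \<in> carrier G" using C.V_carrier[OF g_V] .
  have "n0 \<le> Suc n" by (simp add: n_def)
  from C.V_antimono[OF this] have "g n \<in> V n0" using g_V[of n] by blast
  then have "g n \<in> U" "?e \<in> U" using n0 O' by auto
  then have "d (g n) ?e \<le> K * C.chain_dist (g n) ?e" by (rule dom)
  also have "C.chain_dist (g n) ?e = C.chain_norm (g n)"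
    using gn C.chain_norm_inv by (simp add: C.chain_dist_def)
  also have "K * C.chain_norm (g n) \<le> K * (C.scale n / real (k n))"
    using C.chain_norm_le_scale[OF g_V[of n]] K unfolding C.scale_Suc by (intro mult_left_mono) auto
  also have "\<dots> < 1 / real (k n)"
  proof -
    have "C.scale n \<le> C.scale n1" using C.scale_less_iff[of n1 n] n_def by (metis linorder_not_le max.cobounded2)
    then have "C.scale n < 1 / K" using n1 by simp
    then have "K * C.scale n < 1" using K by (simp add: field_simps)
    from divide_strict_right_mono[OF this k_pos] show ?thesis by simp
  qed
  also have "\<dots> \<le> d (g n) ?e"
    using k_g[of n] unfolding pos_divide_le_eq[OF k_pos] by (simp only: mult.commute)
  finally show False by simp
qed

text \<open>Some power \<open>g\<^bsup>i\<^esup>\<close> with \<open>i\<close> of order \<open>1 / N g\<close> leaves the \<open>\<epsilon>\<close>-ball. Writing \<open>i = q * m + r\<close>, the remainder \<open>g\<^bsup>r\<^esup>\<close>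
  contributes at most \<open>m * N g \<le> \<epsilon> / 2\<close>, so the \<open>q\<close> factors \<open>g\<^bsup>m\<^esup>\<close> must make up for \<open>\<epsilon> / 2\<close>. Since \<open>q\<close> is of
  order at most \<open>1 / (m * N g)\<close>, this bounds \<open>N (g\<^bsup>m\<^esup>)\<close> from below by a multiple of \<open>m * N g\<close>.\<close>

lemma minimal_metric_NSS:
  fixes G :: "'g monoid"
  assumes G: "topological_group G T" and d: "minimal_metric G T d"
    and n_mono: "strict_mono n" and n_0: "n 0 = 1"
    and ratio: "\<And>k. real (n (Suc k)) \<le> c * real (n k)"
  shows "NSS G T n"
proof -
  interpret topological_group G T by (rule G)
  have metric: "Metric_space (carrier G) d" and top: "Metric_space.mtopology (carrier G) d = T"
    and left: "\<And>h g f. h \<in> carrier G \<Longrightarrow> g \<in> carrier G \<Longrightarrow> f \<in> carrier G \<Longrightarrow>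
      d (h \<otimes>\<^bsub>G\<^esub> g) (h \<otimes>\<^bsub>G\<^esub> f) = d g f"
    using d by (auto simp: minimal_metric_def compatible_left_invariant_metric_def)
  interpret M: Metric_space "carrier G" d by (rule metric)
  let ?e = "\<one>\<^bsub>G\<^esub>"
  define N where "N g = d g ?e" for g
  have N_nonneg: "N g \<ge> 0" for g by (simp add: N_def)
  have N_mult: "N (x \<otimes>\<^bsub>G\<^esub> y) \<le> N x + N y" if "x \<in> carrier G" "y \<in> carrier G" for x y
    using M.triangle[of "x \<otimes>\<^bsub>G\<^esub> y" x ?e] left[of x y ?e] that by (simp add: N_def)
  have N_pow: "N (g [^]\<^bsub>G\<^esub> i) \<le> real i * N g" if g: "g \<in> carrier G" for g and i :: nat
  proof (induction i)
    case (Suc i)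
    then show ?case using N_mult[of "g [^]\<^bsub>G\<^esub> i" g] g by (simp add: algebra_simps)
  qed (simp add: N_def)
  obtain \<epsilon> where \<epsilon>: "\<epsilon> > 0" and escape: "\<And>g. g \<in> carrier G \<Longrightarrow> g \<noteq> ?e \<Longrightarrow>
      \<exists>i\<le>2 * nat \<lceil>1 / N g\<rceil> + 1. N (g [^]\<^bsub>G\<^esub> i) \<ge> \<epsilon>"
    using minimal_metric_power_escape[OF G d] unfolding N_def by blast
  have growth: "real m * N g \<le> 10 / \<epsilon> * N (g [^]\<^bsub>G\<^esub> m)"
    if g: "g \<in> carrier G" and "N g < 1" and m: "real m * N g \<le> \<epsilon> / 2" for g m
  proof (cases "m = 0 \<or> g = ?e")
    case True
    then show ?thesis using \<epsilon> by (auto simp: N_def)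
  next
    case False
    then have Ng: "N g > 0" and "m > 0" using g M.mdist_pos_eq[of g ?e] by (auto simp: N_def)
    obtain i where i: "i \<le> 2 * nat \<lceil>1 / N g\<rceil> + 1" and far: "N (g [^]\<^bsub>G\<^esub> i) \<ge> \<epsilon>"
      using escape[OF g] False by blast
    define h where "h = g [^]\<^bsub>G\<^esub> m"
    have hG: "h \<in> carrier G" using g by (simp add: h_def)
    let ?q = "i div m" and ?r = "i mod m"
    have "1 / N g > 1" using Ng \<open>N g < 1\<close> by simp
    \<comment> \<open>\<open>2 * \<lceil>1 / N g\<rceil> + 1 \<le> 2 / N g + 3\<close>, and \<open>3 \<le> 3 / N g\<close> because \<open>N g < 1\<close>.\<close>
    have "real i \<le> 5 * (1 / N g)" using i \<open>1 / N g > 1\<close> by linarith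
    then have "real i * N g \<le> 5" using Ng by (simp add: field_simps)
    have "real (?q * m) \<le> real i" by (simp only: of_nat_le_iff div_times_less_eq_dividend)
    then have "real (?q * m) * N g \<le> 5"
      using \<open>real i * N g \<le> 5\<close> N_nonneg[of g] by (meson mult_right_mono order_trans)
    have "g [^]\<^bsub>G\<^esub> i = h [^]\<^bsub>G\<^esub> ?q \<otimes>\<^bsub>G\<^esub> g [^]\<^bsub>G\<^esub> ?r"
      using g by (simp add: h_def nat_pow_pow nat_pow_mult)
    then have "\<epsilon> \<le> N (h [^]\<^bsub>G\<^esub> ?q) + N (g [^]\<^bsub>G\<^esub> ?r)"
      using far N_mult[of "h [^]\<^bsub>G\<^esub> ?q" "g [^]\<^bsub>G\<^esub> ?r"] g hG by simp
    also have "\<dots> \<le> real ?q * N h + real ?r * N g"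
      using N_pow[OF hG] N_pow[OF g] by (intro add_mono)
    also have "real ?r * N g \<le> real m * N g"
      using \<open>m > 0\<close> N_nonneg by (intro mult_right_mono) (simp_all add: less_imp_le)
    finally have "\<epsilon> / 2 \<le> real ?q * N h" using m by linarith
    then have "\<epsilon> / 2 * (real m * N g) \<le> real ?q * N h * (real m * N g)"
      using N_nonneg[of g] by (intro mult_right_mono) auto
    also have "\<dots> = (real (?q * m) * N g) * N h" by simp
    also have "\<dots> \<le> 5 * N h"
      using \<open>real (?q * m) * N g \<le> 5\<close> N_nonneg by (intro mult_right_mono)
    finally show ?thesis using \<epsilon> by (simp add: field_simps h_def)
  qed
  show ?thesis
  proof (rule NSS_of_linear_power_growth[OF group_axioms n_mono n_0 ratio, where A = "{g \<in> carrier G. N g < 1}"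
        and N = N and R = "\<epsilon> / 2" and K = "10 / \<epsilon>"])
    fix r :: real assume "r > 0"
    have "{g \<in> {g \<in> carrier G. N g < 1}. N g < r} = M.mball ?e (min 1 r)"
      by (auto simp: N_def M.commute)
    moreover have "openin T (M.mball ?e (min 1 r))" using M.openin_mball top by metis
    ultimately show "is_nbhd T ?e {g \<in> {g \<in> carrier G. N g < 1}. N g < r}"
      using openin_subset \<open>r > 0\<close> unfolding is_nbhd_def
      by (intro conjI exI[of _ "M.mball ?e (min 1 r)"]) auto
  next
    fix g assume "g \<in> {g \<in> carrier G. N g < 1}" "N g = 0"
    then show "g = ?e" using M.zero[of g ?e] by (simp add: N_def)
  next
    fix g m assume "g \<in> {g \<in> carrier G. N g < 1}" "real m * N g \<le> \<epsilon> / 2"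
    then show "real m * N g \<le> 10 / \<epsilon> * N (g [^]\<^bsub>G\<^esub> m)" using growth by blast
  qed (use \<epsilon> N_nonneg in auto)
qed


section \<open>NSS sequences for both classes\<close>

theorem theorem2p9:
  fixes n :: "nat \<Rightarrow> nat" and c :: real
  assumes "strict_mono n" and "\<And>k. n k > 0" and "n 0 = 1"
    and "(SUP k. ereal (real (n (Suc k)) / real (n k))) \<le> ereal c"
  shows "NSS_for_class (banach_lie_groups TYPE('e::banach) :: ('g monoid \<times> 'g topology) set) n \<and>
         NSS_for_class (minimal_metric_groups :: ('h monoid \<times> 'h topology) set) n"
proof -
  have ratio: "real (n (Suc k)) \<le> c * real (n k)" for k
  proof -
    have "ereal (real (n (Suc k)) / real (n k)) \<le> ereal c"
      using assms(4) by (rule order_trans[rotated]) (rule SUP_upper, simp)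
    then show ?thesis using assms(2)[of k] by (simp add: field_simps)
  qed
  have "NSS G T n"
    if "(G, T) \<in> (banach_lie_groups TYPE('e) :: ('g monoid \<times> 'g topology) set)" for G T
    using that
    by (auto simp: banach_lie_groups_def real_lie_group_def complex_lie_group_def
        intro: lie_group_NSS[OF _ assms(1,3) ratio])
  moreover have "NSS G T n"
    if "(G, T) \<in> (minimal_metric_groups :: ('h monoid \<times> 'h topology) set)" for G T
    using that minimal_metric_NSS[OF _ _ assms(1,3) ratio] by (auto simp: minimal_metric_groups_def)
  ultimately show ?thesis unfolding NSS_for_class_def by blast
qed

end
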